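(* Let $G$ be a non-discrete second countable locally compact group satisfying the following property: the inverse $\Gamma^{-1}=\{\gamma^{-1}:\gamma\in\Gamma\}$ of any relatively separated subset $\Gamma\subset G$ is also relatively separated. Then $G$ is not an FT group; that is, there do not exist a subset $\Gamma\subset G$ and $\varphi\in L^2(G)$ such that $(\lambda_G(x)\varphi)_{x\in\Gamma}$ is a frame for $L^2(G)$.
   Context: $L^2(G)$ is taken with respect to left Haar measure, and $\lambda_G$ denotes the left regular representation of $G$ on $L^2(G)$, $(\lambda_G(x)f)(y)=f(x^{-1}y)$. A family $(\eta_i)_{i\in I}$ in a Hilbert space $\mathcal H$ is a frame if there are constants $0<A\le B<\infty$ with $A\|f\|^2\le\sum_{i\in I}|\langle f,\eta_i\rangle|^2\le B\|f\|^2$ for all $f\in\mathcal H$. The group $G$ is an FT group if there exist $\Gamma\subset G$ and $\varphi\in L^2(G)$ such that $(\lambda_G(x)\varphi)_{x\in\Gamma}$ is a frame for $L^2(G)$. A subset $\Gamma\subset G$ is (left) relatively separated if $\sup_{x\in G}\sharp(\Gamma\cap xU)<\infty$ for some (and hence all) relatively compact neighborhoods $U$ of the identity, where $\sharp$ denotes cardinality. *)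

theory Defs
  imports "HOL-Analysis.Analysis"
begin

text \<open>
  Groups are written additively, following the class \<^class>\<open>topological_group_add\<close>, which does
  \<^emph>\<open>not\<close> assume commutativity: the group product \<open>xy\<close> is \<open>x + y\<close>, the inverse is \<open>- x\<close> and the
  identity is \<open>0\<close>.
\<close>

definition relatively_separated :: "'a::topological_group_add set \<Rightarrow> bool" where
  "relatively_separated \<Gamma> \<longleftrightarrow>
    (\<exists>U. 0 \<in> interior U \<and> compact (closure U) \<and>
      (\<exists>N::nat. \<forall>x. finite (\<Gamma> \<inter> (+) x ` U) \<and> card (\<Gamma> \<inter> (+) x ` U) \<le> N))"

text \<open>
  A left Haar measure is a nonzero left-invariant Radon measure on the Borel sets. The two
  regularity clauses are automatic for second countable locally compact Hausdorff groups.
\<close>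

definition left_haar_measure :: "'a::{topological_group_add, t2_space} measure \<Rightarrow> bool" where
  "left_haar_measure \<mu> \<longleftrightarrow>
    sets \<mu> = sets borel \<and>
    emeasure \<mu> UNIV \<noteq> 0 \<and>
    (\<forall>K. compact K \<longrightarrow> emeasure \<mu> K < \<infinity>) \<and>
    (\<forall>A\<in>sets borel. emeasure \<mu> A = (INF V\<in>{V. open V \<and> A \<subseteq> V}. emeasure \<mu> V)) \<and>
    (\<forall>V. open V \<longrightarrow> emeasure \<mu> V = (SUP K\<in>{K. compact K \<and> K \<subseteq> V}. emeasure \<mu> K)) \<and>
    (\<forall>x. \<forall>A\<in>sets borel. emeasure \<mu> ((+) x ` A) = emeasure \<mu> A)"

text \<open>
  Elements of \<open>L\<^sup>2\<close> are represented by square-integrable functions rather than by classes modulo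
  almost-everywhere equality; the inner product and hence the frame property below depend only on
  the classes.
\<close>

definition L2_space :: "'a measure \<Rightarrow> ('a \<Rightarrow> complex) set" where
  "L2_space M = {f \<in> borel_measurable M. integrable M (\<lambda>x. (cmod (f x))\<^sup>2)}"

definition L2_inner :: "'a measure \<Rightarrow> ('a \<Rightarrow> complex) \<Rightarrow> ('a \<Rightarrow> complex) \<Rightarrow> complex" where
  "L2_inner M f g = (LINT x|M. f x * cnj (g x))"

definition L2_norm :: "'a measure \<Rightarrow> ('a \<Rightarrow> complex) \<Rightarrow> real" where
  "L2_norm M f = sqrt (LINT x|M. (cmod (f x))\<^sup>2)"

text \<open>The sum is taken in \<^typ>\<open>ennreal\<close>, so that a divergent series has value \<open>\<infinity>\<close>.\<close>

definition L2_frame :: "'a measure \<Rightarrow> 'i set \<Rightarrow> ('i \<Rightarrow> 'a \<Rightarrow> complex) \<Rightarrow> bool" where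
  "L2_frame M I \<eta> \<longleftrightarrow>
    (\<forall>i\<in>I. \<eta> i \<in> L2_space M) \<and>
    (\<exists>A B::real. 0 < A \<and> A \<le> B \<and>
      (\<forall>f\<in>L2_space M.
        ennreal (A * (L2_norm M f)\<^sup>2) \<le> (\<Sum>\<^sub>\<infinity>i\<in>I. ennreal ((cmod (L2_inner M f (\<eta> i)))\<^sup>2)) \<and>
        (\<Sum>\<^sub>\<infinity>i\<in>I. ennreal ((cmod (L2_inner M f (\<eta> i)))\<^sup>2)) \<le> ennreal (B * (L2_norm M f)\<^sup>2)))"

definition left_regular :: "'a::group_add \<Rightarrow> ('a \<Rightarrow> complex) \<Rightarrow> ('a \<Rightarrow> complex)" where
  "left_regular x f = (\<lambda>y. f (- x + y))"

text \<open>
  The measure argument is meant to be a left Haar measure; the property does not depend on its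
  normalization.
\<close>

definition FT_group :: "'a::topological_group_add measure \<Rightarrow> bool" where
  "FT_group \<mu> \<longleftrightarrow>
    (\<exists>\<Gamma>. \<exists>\<phi>\<in>L2_space \<mu>. L2_frame \<mu> \<Gamma> (\<lambda>x. left_regular x \<phi>))"

end

theory Submission
  imports Defs
begin

text \<open>
  Suppose that \<open>(\<lambda>(\<gamma>) \<phi>)\<close>, \<open>\<gamma> \<in> \<Gamma>\<close>, is a frame with lower bound \<open>A\<close>. The upper frame bound forces \<open>\<Gamma>\<close>
  to be relatively separated, hence so is \<open>-\<Gamma>\<close>. Therefore, for all sufficiently small open
  neighbourhoods \<open>E\<close> of \<open>0\<close>, the sets \<open>-\<gamma> + E\<close> cover each point at most \<open>N\<close> times, with \<open>N\<close>
  independent of \<open>E\<close>. Testing the lower frame bound on the indicator of \<open>E\<close> and applying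
  Cauchy-Schwarz on \<open>E\<close> to each coefficient, the factor \<open>\<mu>(E)\<close> cancels and leaves
  \<open>A \<le> N \<integral> |\<phi>|\<^sup>2\<close>, the integral being over \<open>-\<Gamma> + E\<close>. As \<open>E\<close> shrinks to \<open>0\<close>, these sets shrink to
  the countable set \<open>-\<Gamma>\<close>, which is a null set because \<open>G\<close> is not discrete, and dominated
  convergence gives \<open>A \<le> 0\<close>.
\<close>

section \<open>Translations, neighbourhoods of 0 and countability\<close>

lemma image_left_translation_eq_vimage:
  fixes a :: "'a::group_add"
  shows "(+) a ` S = (+) (- a) -` S"
proof (rule set_eqI)
  fix x
  have "x \<in> (+) a ` S" if "- a + x \<in> S"
    by (rule image_eqI[OF _ that]) simp
  moreover have "- a + x \<in> S" if "x \<in> (+) a ` S"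
    using that by auto
  ultimately show "x \<in> (+) a ` S \<longleftrightarrow> x \<in> (+) (- a) -` S"
    by auto
qed

lemma continuous_left_translation:
  "continuous_on S ((+) (a::'a::topological_group_add))"
  by (intro continuous_intros)

lemma open_left_translation:
  fixes a :: "'a::topological_group_add"
  assumes "open S"
  shows "open ((+) a ` S)"
  unfolding image_left_translation_eq_vimage
  by (intro open_vimage assms continuous_left_translation)

lemma open_uminus_image:
  fixes S :: "'a::topological_group_add set"
  assumes "open S"
  shows "open (uminus ` S)"
proof -
  have "uminus ` S = uminus -` S"
    by (force intro: image_eqI[where x="- x" for x])
  moreover have "open (uminus -` S)"
    by (intro open_vimage assms continuous_intros)
  ultimately show ?thesis
    by simp
qed

text \<open>Every \<open>x\<close> lies in its own translate \<open>x + U\<close>, so the open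
  translates cover the group and Lindelof's theorem extracts a countable subcover. This is where
  second countability turns local information at 0 into global information.\<close>

lemma countable_left_translates_cover:
  fixes U :: "'a::{topological_group_add, second_countable_topology} set"
  assumes "open U" "0 \<in> U"
  obtains C where "countable C" "(\<Union>x\<in>C. (+) x ` U) = UNIV"
proof -
  obtain F where F: "F \<subseteq> range (\<lambda>x. (+) x ` U)" "countable F" "\<Union>F = (\<Union>x. (+) x ` U)"
    using Lindelof[of "range (\<lambda>x. (+) x ` U)"] open_left_translation[OF assms(1)] by blast
  obtain C where C: "countable C" "F = (\<lambda>x. (+) x ` U) ` C"
    using F(1,2) by (metis countable_subset_image)
  have "x \<in> (+) x ` U" for x
    using assms(2) by (force intro: image_eqI[where x=0])
  then have "(\<Union>x. (+) x ` U) = UNIV"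
    by blast
  then show ?thesis
    using C F(3) that by auto
qed

text \<open>Countably many translates of a neighbourhood cover the group, and each meets \<Gamma> in
  a finite set.\<close>

lemma relatively_separated_countable:
  fixes \<Gamma> :: "'a::{topological_group_add, second_countable_topology} set"
  assumes "relatively_separated \<Gamma>"
  shows "countable \<Gamma>"
proof -
  obtain U where U: "0 \<in> interior U" and fin: "\<And>x. finite (\<Gamma> \<inter> (+) x ` U)"
    using assms unfolding relatively_separated_def by blast
  obtain C where C: "countable C" "(\<Union>x\<in>C. (+) x ` interior U) = UNIV"
    using countable_left_translates_cover[OF open_interior U] by blast
  have "\<Gamma> \<subseteq> (\<Union>x\<in>C. \<Gamma> \<inter> (+) x ` U)"
  proof
    fix g assume g: "g \<in> \<Gamma>"
    from C(2) have "g \<in> (\<Union>x\<in>C. (+) x ` interior U)" by blast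
    then obtain x u where "x \<in> C" "g = x + u" "u \<in> interior U"
      by blast
    with g interior_subset show "g \<in> (\<Union>x\<in>C. \<Gamma> \<inter> (+) x ` U)"
      by blast
  qed
  moreover have "countable (\<Union>x\<in>C. \<Gamma> \<inter> (+) x ` U)"
    using C(1) countable_finite[OF fin] by blast
  ultimately show ?thesis
    by (rule countable_subset)
qed

section \<open>Left Haar measure: invariance, open sets and points\<close>

lemma left_haar_measureD:
  assumes "left_haar_measure \<mu>"
  shows sets_left_haar_measure: "sets \<mu> = sets borel"
    and left_haar_measure_nonzero: "emeasure \<mu> UNIV \<noteq> 0"
    and left_haar_measure_compact_finite: "compact K \<Longrightarrow> emeasure \<mu> K < \<infinity>"
    and left_haar_measure_outer_regular:
      "A \<in> sets borel \<Longrightarrow> emeasure \<mu> A = (INF V\<in>{V. open V \<and> A \<subseteq> V}. emeasure \<mu> V)"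
    and left_haar_measure_translate:
      "A \<in> sets borel \<Longrightarrow> emeasure \<mu> ((+) x ` A) = emeasure \<mu> A"
proof -
  note D = assms[unfolded left_haar_measure_def]
  show "sets \<mu> = sets borel"
    by (rule D[THEN conjunct1])
  show "emeasure \<mu> UNIV \<noteq> 0"
    by (rule D[THEN conjunct2, THEN conjunct1])
  show "compact K \<Longrightarrow> emeasure \<mu> K < \<infinity>"
    by (rule D[THEN conjunct2, THEN conjunct2, THEN conjunct1, rule_format])
  show "A \<in> sets borel \<Longrightarrow> emeasure \<mu> A = (INF V\<in>{V. open V \<and> A \<subseteq> V}. emeasure \<mu> V)"
    by (rule D[THEN conjunct2, THEN conjunct2, THEN conjunct2, THEN conjunct1, rule_format])
  show "A \<in> sets borel \<Longrightarrow> emeasure \<mu> ((+) x ` A) = emeasure \<mu> A"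
    by (rule D[THEN conjunct2, THEN conjunct2, THEN conjunct2, THEN conjunct2, THEN conjunct2, rule_format])
qed

lemma borel_measurable_left_translation:
  "(+) (x::'a::topological_group_add) \<in> borel \<rightarrow>\<^sub>M borel"
  by (intro borel_measurable_continuous_onI continuous_left_translation)

lemma left_haar_measure_measurable_translation:
  assumes "left_haar_measure \<mu>"
  shows "(+) x \<in> \<mu> \<rightarrow>\<^sub>M \<mu>"
  using borel_measurable_left_translation[of x] sets_left_haar_measure[OF assms]
  by (simp cong: measurable_cong_sets)

text \<open>Invariance as equality of push-forward measures is the form that the change of variables
  in \<open>L2_inner_left_regular\<close> and \<open>nn_integral_left_translation\<close>
  uses.\<close>

lemma left_haar_measure_distr_translation:
  assumes "left_haar_measure \<mu>"
  shows "distr \<mu> \<mu> ((+) x) = \<mu>"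
proof (rule measure_eqI)
  fix A assume "A \<in> sets (distr \<mu> \<mu> ((+) x))"
  then have A: "A \<in> sets \<mu>" by simp
  have sp: "space \<mu> = UNIV"
    using sets_eq_imp_space_eq[OF sets_left_haar_measure[OF assms]] by simp
  have "emeasure (distr \<mu> \<mu> ((+) x)) A = emeasure \<mu> ((+) x -` A)"
    using A by (simp add: emeasure_distr left_haar_measure_measurable_translation[OF assms] sp)
  also have "(+) x -` A = (+) (- x) ` A"
    by (simp add: image_left_translation_eq_vimage)
  finally show "emeasure (distr \<mu> \<mu> ((+) x)) A = emeasure \<mu> A"
    using left_haar_measure_translate[OF assms] A sets_left_haar_measure[OF assms] by simp
qed simp

text \<open>If \<open>U\<close> were null, so would be its translates, countably many of which cover
  the group.\<close>

lemma left_haar_measure_open_pos: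
  fixes \<mu> :: "'a::{topological_group_add, t2_space, second_countable_topology} measure"
  assumes haar: "left_haar_measure \<mu>" and U: "open U" "0 \<in> U"
  shows "emeasure \<mu> U > 0"
proof (rule ccontr)
  assume "\<not> emeasure \<mu> U > 0"
  then have 0: "emeasure \<mu> U = 0" by simp
  obtain C where C: "countable C" "(\<Union>x\<in>C. (+) x ` U) = UNIV"
    using countable_left_translates_cover[OF U] by blast
  have "(+) x ` U \<in> null_sets \<mu>" for x
    using 0 U(1) left_haar_measure_translate[OF haar, of U x] open_left_translation[OF U(1)]
    by (auto simp: null_sets_def sets_left_haar_measure[OF haar])
  then have "(\<Union>x\<in>C. (+) x ` U) \<in> null_sets \<mu>"
    by (intro null_sets_UN' C)
  then have "emeasure \<mu> UNIV = 0"
    by (simp add: C(2) null_sets_def)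
  with left_haar_measure_nonzero[OF haar] show False
    by blast
qed

text \<open>By invariance all points have the same mass \<open>c\<close>. If \<open>c\<close> were
  positive, the finite measure \<open>m\<close> of \<open>K\<close> would allow at most
  \<open>m / c\<close> points in \<open>K\<close>; a finite neighbourhood of 0 in a Hausdorff group
  makes 0 isolated, and by translation the group is discrete.\<close>

lemma left_haar_measure_singleton:
  fixes \<mu> :: "'a::{topological_group_add, t2_space, second_countable_topology} measure"
  assumes haar: "left_haar_measure \<mu>"
    and K: "compact K" "(0::'a) \<in> interior K"
    and non_discrete: "\<not> (\<forall>S::'a set. open S)"
  shows "emeasure \<mu> {x} = 0"
proof (rule ccontr)
  assume nz: "emeasure \<mu> {x} \<noteq> 0"
  have pt: "emeasure \<mu> {y} = emeasure \<mu> {0}" for y :: 'a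
  proof -
    have "(+) y ` {0} = {y}" by auto
    with left_haar_measure_translate[OF haar, of "{0}" y] show ?thesis
      by (simp only: borel_singleton sets.empty_sets)
  qed
  have "compact {0::'a}" by simp
  then have fin0: "emeasure \<mu> {0} < \<infinity>" and finK: "emeasure \<mu> K < \<infinity>"
    using left_haar_measure_compact_finite[OF haar] K(1) by blast+
  define c where "c = measure \<mu> {0}"
  have c: "emeasure \<mu> {y} = ennreal c" for y :: 'a
    unfolding c_def using pt[of y] fin0 by (metis emeasure_eq_ennreal_measure infinity_ennreal_def less_irrefl)
  have cpos: "c > 0"
    using nz c[of x] by (auto simp: ennreal_eq_0_iff not_le)
  obtain m where m: "emeasure \<mu> K = ennreal m" "m \<ge> 0"
    using finK by (cases "emeasure \<mu> K") auto
  have "card F \<le> nat \<lceil>m / c\<rceil>" if F: "F \<subseteq> K" "finite F" for F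
  proof -
    have "emeasure \<mu> F = (\<Sum>y\<in>F. emeasure \<mu> {y})"
      using F(2) by (intro emeasure_eq_sum_singleton) (auto simp: sets_left_haar_measure[OF haar])
    also have "\<dots> = ennreal (card F * c)"
      using cpos by (simp add: c ennreal_mult flip: ennreal_of_nat_eq_real_of_nat)
    finally have "ennreal (card F * c) \<le> ennreal m"
      using emeasure_mono[OF F(1), of \<mu>] K(1)
      by (simp add: m sets_left_haar_measure[OF haar] borel_compact)
    then have "card F * c \<le> m"
      using m by (simp add: ennreal_le_iff)
    then have "card F \<le> m / c"
      using cpos by (simp add: field_simps)
    then show ?thesis
      by linarith
  qed
  then have "finite K"
    using finite_if_finite_subsets_card_bdd by blast
  \<comment> \<open>Removing the finite, hence closed, set \<open>interior K - {0}\<close> from the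
    open set \<open>interior K\<close> leaves only 0.\<close>
  then have "open (interior K - (interior K - {0}))"
    by (intro open_Diff finite_imp_closed open_interior)
       (meson Diff_subset finite_subset interior_subset)
  moreover have "interior K - (interior K - {0}) = {0}"
    using K by auto
  ultimately have "open {0::'a}" by simp
  then have "open {y}" for y :: 'a
    using open_left_translation[of "{0}" y] by simp
  then have "open S" for S :: "'a set"
    using open_UN[of S "\<lambda>y. {y}"] by simp
  with non_discrete show False by blast
qed

section \<open>Cauchy-Schwarz on a set, and continuity of translation in measure\<close>

text \<open>Cauchy-Schwarz against the indicator of \<open>S\<close>, on which \<open>h\<close> is
  supported. If \<open>h\<close> is not integrable, its Bochner integral is 0 by convention and the
  bound is trivial, so callers need not check integrability.\<close>

lemma norm_integral_squared_le_emeasure_mult: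
  fixes h :: "'a \<Rightarrow> complex" and f :: "'a \<Rightarrow> complex"
  assumes [measurable]: "f \<in> borel_measurable M" "S \<in> sets M"
    and le: "\<And>x. cmod (h x) \<le> indicator S x * cmod (f x)"
  shows "ennreal ((cmod (LINT x|M. h x))\<^sup>2) \<le>
    emeasure M S * (\<integral>\<^sup>+x. ennreal ((cmod (f x))\<^sup>2) * indicator S x \<partial>M)"
proof (cases "integrable M h")
  case True
  have "ennreal (cmod (LINT x|M. h x)) \<le> (\<integral>\<^sup>+x. ennreal (cmod (h x)) \<partial>M)"
    by (rule integral_norm_bound_ennreal[OF True])
  also have "\<dots> \<le> (\<integral>\<^sup>+x. indicator S x * (ennreal (cmod (f x)) * indicator S x) \<partial>M)"
  proof (intro nn_integral_mono)
    fix x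
    show "ennreal (cmod (h x)) \<le> indicator S x * (ennreal (cmod (f x)) * indicator S x)"
      using le[of x] by (cases "x \<in> S") (auto intro: ennreal_leI)
  qed
  finally have "ennreal (cmod (LINT x|M. h x)) ^ 2 \<le>
      (\<integral>\<^sup>+x. indicator S x * (ennreal (cmod (f x)) * indicator S x) \<partial>M) ^ 2"
    by (rule power_mono) simp
  also have "\<dots> \<le> (\<integral>\<^sup>+x. (indicator S x)\<^sup>2 \<partial>M) *
      (\<integral>\<^sup>+x. (ennreal (cmod (f x)) * indicator S x)\<^sup>2 \<partial>M)"
    by (rule Cauchy_Schwarz_nn_integral) measurable
  also have "(\<integral>\<^sup>+x. (indicator S x)\<^sup>2 \<partial>M) = (\<integral>\<^sup>+x. indicator S x \<partial>M)"
    by (intro nn_integral_cong) (auto simp: indicator_def)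
  also have "\<dots> = emeasure M S"
    by simp
  also have "(\<integral>\<^sup>+x. (ennreal (cmod (f x)) * indicator S x)\<^sup>2 \<partial>M) =
      (\<integral>\<^sup>+x. ennreal ((cmod (f x))\<^sup>2) * indicator S x \<partial>M)"
    by (intro nn_integral_cong) (auto simp: indicator_def ennreal_power)
  finally show ?thesis
    by (simp add: ennreal_power)
next
  case False
  then show ?thesis
    by (simp add: not_integrable_integral_eq)
qed

text \<open>The preimage of \<open>V\<close> under addition is an open set containing
  \<open>{0} \<times> K\<close>; the tube lemma thickens 0 to a neighbourhood.\<close>

lemma translate_compact_subset_open:
  fixes K :: "'a::topological_group_add set"
  assumes "compact K" "open V" "K \<subseteq> V"
  obtains W where "open W" "0 \<in> W" "\<And>u k. u \<in> W \<Longrightarrow> k \<in> K \<Longrightarrow> u + k \<in> V"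
proof -
  have "open ((\<lambda>p. fst p + snd p) -` V :: ('a \<times> 'a) set)"
    by (intro open_vimage assms continuous_intros)
  moreover have "{0} \<times> K \<subseteq> (\<lambda>p. fst p + snd p) -` V"
    using assms by auto
  ultimately obtain W where W: "0 \<in> W" "open W" "W \<times> K \<subseteq> (\<lambda>p. fst p + snd p) -` V"
    using Elementary_Topology.tube_lemma[OF assms(1)] by blast
  show ?thesis
  proof (rule that[of W])
    fix u k assume "u \<in> W" "k \<in> K"
    then have "(u, k) \<in> (\<lambda>p. fst p + snd p) -` V"
      using W(3) by blast
    then show "u + k \<in> V" by simp
  qed (use W in auto)
qed

text \<open>Outer regularity encloses \<open>K\<close> in an open \<open>V\<close> of measure less
  than \<open>e / 2\<close> larger. For \<open>u\<close> near 0 the translate \<open>u + K\<close>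
  stays inside \<open>V\<close> and has the measure of \<open>K\<close>. So \<open>V - K\<close> and
  \<open>V - (u + K)\<close> each have measure at most \<open>e / 2\<close>, and together they
  contain the symmetric difference.\<close>

lemma left_haar_measure_compact_sym_diff:
  fixes \<mu> :: "'a::{topological_group_add, t2_space} measure"
  assumes haar: "left_haar_measure \<mu>" and K: "compact K" and e: "e > (0::real)"
  obtains W where "open W" "0 \<in> W"
    "\<And>u. u \<in> W \<Longrightarrow> emeasure \<mu> (((+) u ` K - K) \<union> (K - (+) u ` K)) \<le> ennreal e"
proof -
  have setsK [simp]: "K \<in> sets \<mu>" "\<And>u. (+) u ` K \<in> sets \<mu>"
    using K compact_continuous_image[OF continuous_left_translation K]
    by (auto simp: sets_left_haar_measure[OF haar] intro!: borel_compact)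
  have finK: "emeasure \<mu> K < \<infinity>"
    by (rule left_haar_measure_compact_finite[OF haar K])
  define d where "d = ennreal (e / 2)"
  have d: "d > 0" "d + d = ennreal e"
    using e unfolding d_def by (simp_all flip: ennreal_plus)
  have "emeasure \<mu> K = (INF V\<in>{V. open V \<and> K \<subseteq> V}. emeasure \<mu> V)"
    by (rule left_haar_measure_outer_regular[OF haar borel_compact[OF K]])
  moreover have "emeasure \<mu> K < emeasure \<mu> K + d"
    using finK d by (simp add: ennreal_add_left_cancel_less)
  ultimately obtain V where V: "open V" "K \<subseteq> V" "emeasure \<mu> V < emeasure \<mu> K + d"
    by (auto simp: INF_less_iff)
  obtain W where W: "open W" "0 \<in> W" "\<And>u k. u \<in> W \<Longrightarrow> k \<in> K \<Longrightarrow> u + k \<in> V"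
    using translate_compact_subset_open[OF K V(1,2)] by blast
  have setsV [simp]: "V \<in> sets \<mu>"
    using V by (simp add: sets_left_haar_measure[OF haar])
  have VL: "emeasure \<mu> (V - L) \<le> d"
    if L: "L \<in> sets \<mu>" "L \<subseteq> V" "emeasure \<mu> L = emeasure \<mu> K" for L
  proof -
    have "emeasure \<mu> (V - L) = emeasure \<mu> V - emeasure \<mu> L"
      using L finK by (intro emeasure_Diff) auto
    also have "\<dots> \<le> d"
      using V(3) L(3) finK by (auto simp: ennreal_minus_le_iff less_imp_le)
    finally show ?thesis .
  qed
  have "emeasure \<mu> (((+) u ` K - K) \<union> (K - (+) u ` K)) \<le> ennreal e" if u: "u \<in> W" for u
  proof -
    have sub: "(+) u ` K \<subseteq> V"
      using W(3) u by blast
    have "emeasure \<mu> (((+) u ` K - K) \<union> (K - (+) u ` K))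
        \<le> emeasure \<mu> ((V - K) \<union> (V - (+) u ` K))"
      using sub V(2) by (intro emeasure_mono sets.Un sets.Diff setsV setsK) auto
    also have "\<dots> \<le> emeasure \<mu> (V - K) + emeasure \<mu> (V - (+) u ` K)"
      by (intro emeasure_subadditive sets.Diff setsV setsK)
    also have "\<dots> \<le> d + d"
      using sub V(2) left_haar_measure_translate[OF haar, of K u] borel_compact[OF K]
      by (intro add_mono VL) auto
    finally show ?thesis
      using d by simp
  qed
  with W(1,2) that show ?thesis
    by blast
qed

section \<open>The left regular representation on square-integrable functions\<close>

lemma left_regular_add:
  "left_regular x (left_regular y f) = left_regular (x + y) f"
  by (simp only: left_regular_def minus_add add.assoc)

lemma left_regular_indicator:
  "left_regular x (indicator S) = indicator ((+) x ` S)"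
  by (auto simp: left_regular_def image_left_translation_eq_vimage indicator_def)

lemma measurable_left_regular:
  assumes "left_haar_measure \<mu>" "f \<in> borel_measurable \<mu>"
  shows "left_regular x f \<in> borel_measurable \<mu>"
  unfolding left_regular_def
  using measurable_compose[OF left_haar_measure_measurable_translation[OF assms(1)] assms(2)]
  by simp

lemma borel_measurable_cnj [measurable (raw)]:
  "f \<in> borel_measurable M \<Longrightarrow> (\<lambda>x. cnj (f x)) \<in> borel_measurable M"
  by (rule measurable_compose[OF _ borel_measurable_continuous_onI[of cnj]])
     (auto intro: continuous_intros)

lemma L2_inner_left_regular:
  assumes haar: "left_haar_measure \<mu>"
    and [measurable]: "f \<in> borel_measurable \<mu>" "g \<in> borel_measurable \<mu>"
  shows "L2_inner \<mu> (left_regular x f) (left_regular x g) = L2_inner \<mu> f g"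
proof -
  have "L2_inner \<mu> f g = (LINT y|distr \<mu> \<mu> ((+) (- x)). f y * cnj (g y))"
    by (simp add: L2_inner_def left_haar_measure_distr_translation[OF haar])
  also have "\<dots> = L2_inner \<mu> (left_regular x f) (left_regular x g)"
    unfolding L2_inner_def left_regular_def
    by (intro integral_distr left_haar_measure_measurable_translation[OF haar]) measurable
  finally show ?thesis ..
qed

lemma nn_integral_left_translation:
  assumes haar: "left_haar_measure \<mu>" and g: "g \<in> borel_measurable \<mu>"
  shows "(\<integral>\<^sup>+y. g (x + y) \<partial>\<mu>) = (\<integral>\<^sup>+y. g y \<partial>\<mu>)"
proof -
  have "(\<integral>\<^sup>+y. g y \<partial>\<mu>) = (\<integral>\<^sup>+y. g y \<partial>distr \<mu> \<mu> ((+) x))"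
    by (simp add: left_haar_measure_distr_translation[OF haar])
  also have "\<dots> = (\<integral>\<^sup>+y. g (x + y) \<partial>\<mu>)"
    using g by (intro nn_integral_distr left_haar_measure_measurable_translation[OF haar]) simp
  finally show ?thesis ..
qed

lemma norm_indicator_complex_power2:
  "(cmod (indicator S x))\<^sup>2 = indicator S x"
  by (auto simp: indicator_def)

lemma indicator_L2_space:
  assumes "S \<in> sets M" "emeasure M S < \<infinity>"
  shows "indicator S \<in> L2_space M"
  using assms by (auto simp: L2_space_def norm_indicator_complex_power2)

lemma L2_norm_indicator:
  assumes "S \<in> sets M"
  shows "(L2_norm M (indicator S))\<^sup>2 = measure M S"
  using assms sets.sets_into_space[OF assms]
  by (simp add: L2_norm_def norm_indicator_complex_power2 Int_absorb2)

lemma L2_space_nn_integral_finite: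
  assumes "f \<in> L2_space M"
  shows "(\<integral>\<^sup>+x. ennreal ((cmod (f x))\<^sup>2) \<partial>M) < \<infinity>"
  using assms by (simp add: L2_space_def integrable_iff_bounded)

text \<open>On a set of finite measure square-integrability implies integrability, because
  \<open>t \<le> 1 + t\<^sup>2\<close> supplies an integrable majorant.\<close>

lemma integrable_indicator_mult_L2:
  assumes f: "f \<in> L2_space M" and S: "S \<in> sets M" "emeasure M S < \<infinity>"
  shows "integrable M (\<lambda>x. indicator S x * cnj (f x))"
proof (rule Bochner_Integration.integrable_bound)
  show "integrable M (\<lambda>x. indicator S x + (cmod (f x))\<^sup>2 :: real)"
    using f S by (intro Bochner_Integration.integrable_add) (auto simp: L2_space_def)
  show "(\<lambda>x. indicator S x * cnj (f x)) \<in> borel_measurable M"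
    using f S by (auto simp: L2_space_def)
  have "t \<le> 1 + t\<^sup>2" for t :: real
    using sum_power2_ge_zero[of "t - 1/2" 0] by (simp add: power2_eq_square algebra_simps)
  then show "AE x in M. norm (indicator S x * cnj (f x)) \<le> norm (indicator S x + (cmod (f x))\<^sup>2)"
    by (intro AE_I2) (auto simp: indicator_def norm_mult)
qed

section \<open>Sums of frame coefficients: relative separation and an overlap bound\<close>

lemma sum_le_infsum_ennreal:
  fixes f :: "'i \<Rightarrow> ennreal"
  assumes "finite F" "F \<subseteq> I"
  shows "sum f F \<le> infsum f I"
  using assms by (subst nonneg_infsum_complete) (auto intro: SUP_upper)

lemma infsum_le_ennreal:
  fixes f :: "'i \<Rightarrow> ennreal"
  assumes "\<And>F. finite F \<Longrightarrow> F \<subseteq> I \<Longrightarrow> sum f F \<le> b"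
  shows "infsum f I \<le> b"
  using assms by (subst nonneg_infsum_complete) (auto intro: SUP_least)

text \<open>
  The coefficients of the indicator of \<open>x + K\<close> against translates \<open>x + u\<close> with \<open>u\<close> close to \<open>0\<close> are
  bounded away from zero uniformly in \<open>x\<close>, so that the Bessel inequality limits the number of such
  translates in \<open>\<Gamma>\<close>.
\<close>

lemma Bessel_imp_relatively_separated:
  fixes \<mu> :: "'a::{topological_group_add, t2_space} measure"
  assumes haar: "left_haar_measure \<mu>"
    and K0: "compact K0" "(0::'a) \<in> interior K0"
    and \<phi>: "\<phi> \<in> L2_space \<mu>"
    and Bessel: "\<And>f. f \<in> L2_space \<mu> \<Longrightarrow>
      (\<Sum>\<^sub>\<infinity>x\<in>\<Gamma>. ennreal ((cmod (L2_inner \<mu> f (left_regular x \<phi>)))\<^sup>2)) \<le> ennreal (B * (L2_norm \<mu> f)\<^sup>2)"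
    and K: "compact K" "L2_inner \<mu> (indicator K) \<phi> \<noteq> 0"
  shows "relatively_separated \<Gamma>"
proof -
  define s where "s = cmod (L2_inner \<mu> (indicator K) \<phi>)"
  have s: "s > 0"
    using K by (simp add: s_def)
  have \<phi>_meas [measurable]: "\<phi> \<in> borel_measurable \<mu>"
    using \<phi> by (simp add: L2_space_def)
  have transl: "(+) u ` K \<in> sets \<mu>" "emeasure \<mu> ((+) u ` K) < \<infinity>" for u
  proof -
    have "compact ((+) u ` K)"
      by (intro compact_continuous_image continuous_left_translation K)
    then show "(+) u ` K \<in> sets \<mu>" "emeasure \<mu> ((+) u ` K) < \<infinity>"
      using left_haar_measure_compact_finite[OF haar, of "(+) u ` K"]
      by (auto simp: sets_left_haar_measure[OF haar] intro: borel_compact)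
  qed
  have setsK [measurable]: "K \<in> sets \<mu>" and finK: "emeasure \<mu> K < \<infinity>"
    using transl[of 0] by auto
  obtain q where q: "(\<integral>\<^sup>+x. ennreal ((cmod (\<phi> x))\<^sup>2) \<partial>\<mu>) = ennreal q" "q \<ge> 0"
    using L2_space_nn_integral_finite[OF \<phi>]
    by (cases "\<integral>\<^sup>+x. ennreal ((cmod (\<phi> x))\<^sup>2) \<partial>\<mu>") auto
  \<comment> \<open>This choice makes the Cauchy-Schwarz bound \<open>e * q\<close> at most
    \<open>(s / 2)\<^sup>2\<close>; adding 1 in the denominator covers the case
    \<open>q = 0\<close>.\<close>
  define e where "e = (s / 2)\<^sup>2 / (q + 1)"
  have e: "e > 0" "e * q \<le> (s / 2)\<^sup>2"
    using s q by (auto simp: e_def field_simps)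
  obtain W where W: "open W" "0 \<in> W"
    and Wle: "\<And>u. u \<in> W \<Longrightarrow> emeasure \<mu> (((+) u ` K - K) \<union> (K - (+) u ` K)) \<le> ennreal e"
    using left_haar_measure_compact_sym_diff[OF haar K(1) e(1)] by blast
  \<comment> \<open>\<open>W\<close> is reflected because translating \<phi> by \<open>u\<close>
    amounts to translating \<open>K\<close> by \<open>- u\<close>. Intersecting with
    \<open>interior K0\<close> makes the closure compact.\<close>
  define U where "U = uminus ` W \<inter> interior K0"
  have openU: "open U" and U0: "0 \<in> U"
    using W K0 by (auto simp: U_def intro!: open_Int open_uminus_image image_eqI[where x=0])
  have "closure U \<subseteq> K0"
    using K0(1) interior_subset[of K0] compact_imp_closed
    by (intro closure_minimal) (auto simp: U_def)
  then have cptU: "compact (closure U)"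
    using compact_Int_closed[OF K0(1) closed_closure[of U]] by (simp add: Int_absorb1)
  \<comment> \<open>By unitarity the coefficient is that of \<phi> against the indicator of
    \<open>- u + K\<close>. This set differs from \<open>K\<close> only in \<open>D\<close>, of
    measure at most \<open>e\<close>, so the coefficient differs from one of modulus
    \<open>s\<close> by at most \<open>s / 2\<close>.\<close>
  have near: "s / 2 \<le> cmod (L2_inner \<mu> (indicator K) (left_regular u \<phi>))" if "u \<in> U" for u
  proof -
    define D where "D = ((+) (- u) ` K - K) \<union> (K - (+) (- u) ` K)"
    have D [measurable]: "D \<in> sets \<mu>"
      unfolding D_def
      by (rule sets.Un[OF sets.Diff[OF transl(1) setsK] sets.Diff[OF setsK transl(1)]])
    have "L2_inner \<mu> (indicator K) (left_regular u \<phi>) =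
        L2_inner \<mu> (left_regular (- u) (indicator K)) (left_regular (- u) (left_regular u \<phi>))"
      using setsK \<phi>_meas by (simp add: L2_inner_left_regular[OF haar] measurable_left_regular[OF haar])
    also have "\<dots> = L2_inner \<mu> (indicator ((+) (- u) ` K)) \<phi>"
      by (simp add: left_regular_add left_regular_indicator) (simp add: left_regular_def)
    finally have 1: "L2_inner \<mu> (indicator K) (left_regular u \<phi>) =
      L2_inner \<mu> (indicator ((+) (- u) ` K)) \<phi>" .
    have "L2_inner \<mu> (indicator ((+) (- u) ` K)) \<phi> - L2_inner \<mu> (indicator K) \<phi> =
        (LINT x|\<mu>. indicator ((+) (- u) ` K) x * cnj (\<phi> x) - indicator K x * cnj (\<phi> x))"
      unfolding L2_inner_def
      by (intro Bochner_Integration.integral_diff[symmetric] integrable_indicator_mult_L2 \<phi>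
          transl setsK finK)
    moreover have "ennreal ((cmod (LINT x|\<mu>. indicator ((+) (- u) ` K) x * cnj (\<phi> x)
        - indicator K x * cnj (\<phi> x)))\<^sup>2)
        \<le> emeasure \<mu> D * (\<integral>\<^sup>+x. ennreal ((cmod (\<phi> x))\<^sup>2) * indicator D x \<partial>\<mu>)"
      using \<phi>_meas D
      by (rule norm_integral_squared_le_emeasure_mult) (auto simp: indicator_def D_def)
    moreover have "emeasure \<mu> D * (\<integral>\<^sup>+x. ennreal ((cmod (\<phi> x))\<^sup>2) * indicator D x \<partial>\<mu>)
        \<le> ennreal e * (\<integral>\<^sup>+x. ennreal ((cmod (\<phi> x))\<^sup>2) \<partial>\<mu>)"
      using Wle[of "- u"] that unfolding D_def U_def
      by (intro mult_mono nn_integral_mono) (auto simp: indicator_def)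
    moreover have "\<dots> \<le> ennreal ((s / 2)\<^sup>2)"
      using e q by (simp flip: ennreal_mult)
    ultimately have "ennreal ((cmod (L2_inner \<mu> (indicator K) (left_regular u \<phi>)
        - L2_inner \<mu> (indicator K) \<phi>))\<^sup>2) \<le> ennreal ((s / 2)\<^sup>2)"
      by (simp only: 1)
    then have "cmod (L2_inner \<mu> (indicator K) (left_regular u \<phi>) - L2_inner \<mu> (indicator K) \<phi>) \<le> s / 2"
      using s by (simp add: power2_le_iff_abs_le)
    then show ?thesis
      using norm_triangle_ineq2[of "L2_inner \<mu> (indicator K) \<phi>" "L2_inner \<mu> (indicator K) (left_regular u \<phi>)"]
      by (simp add: s_def norm_minus_commute)
  qed
  \<comment> \<open>The Bessel inequality for the indicator of \<open>x + K\<close> allows at most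
    this many coefficients of modulus at least \<open>s / 2\<close>. The sign of \<open>B\<close> is
    not given, hence the absolute value.\<close>
  define N where "N = nat \<lceil>\<bar>B\<bar> * measure \<mu> K / (s / 2)\<^sup>2\<rceil>"
  \<comment> \<open>As \<open>card\<close> is 0 on infinite sets, the bound is proved for all finite
    subsets; it then yields finiteness of the intersection as well.\<close>
  have "card F \<le> N" if F: "F \<subseteq> \<Gamma> \<inter> (+) x ` U" "finite F" for F x
  proof -
    let ?f = "indicator ((+) x ` K)"
    have "ennreal (card F * (s / 2)\<^sup>2) = (\<Sum>\<gamma>\<in>F. ennreal ((s / 2)\<^sup>2))"
      by (simp add: ennreal_mult flip: ennreal_of_nat_eq_real_of_nat)
    also have "\<dots> \<le> (\<Sum>\<gamma>\<in>F. ennreal ((cmod (L2_inner \<mu> ?f (left_regular \<gamma> \<phi>)))\<^sup>2))"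
    proof (intro sum_mono ennreal_leI power_mono)
      fix \<gamma> assume "\<gamma> \<in> F"
      then obtain u where u: "\<gamma> = x + u" "u \<in> U"
        using F by blast
      have "L2_inner \<mu> ?f (left_regular \<gamma> \<phi>) =
          L2_inner \<mu> (left_regular x (indicator K)) (left_regular x (left_regular u \<phi>))"
        by (simp add: u left_regular_add left_regular_indicator)
      also have "\<dots> = L2_inner \<mu> (indicator K) (left_regular u \<phi>)"
        using setsK \<phi>_meas by (simp add: L2_inner_left_regular[OF haar] measurable_left_regular[OF haar])
      finally show "s / 2 \<le> cmod (L2_inner \<mu> ?f (left_regular \<gamma> \<phi>))"
        using near[OF u(2)] by simp
    qed (use s in auto)
    also have "\<dots> \<le> (\<Sum>\<^sub>\<infinity>\<gamma>\<in>\<Gamma>. ennreal ((cmod (L2_inner \<mu> ?f (left_regular \<gamma> \<phi>)))\<^sup>2))"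
      using F by (intro sum_le_infsum_ennreal) auto
    also have "\<dots> \<le> ennreal (B * (L2_norm \<mu> ?f)\<^sup>2)"
      by (intro Bessel indicator_L2_space transl)
    also have "(L2_norm \<mu> ?f)\<^sup>2 = measure \<mu> K"
      using left_haar_measure_translate[OF haar, of K x] borel_compact[OF K(1)]
      by (simp add: L2_norm_indicator transl measure_def)
    also have "ennreal (B * measure \<mu> K) \<le> ennreal (\<bar>B\<bar> * measure \<mu> K)"
      by (intro ennreal_leI mult_right_mono) auto
    finally have "card F * (s / 2)\<^sup>2 \<le> \<bar>B\<bar> * measure \<mu> K"
      by (simp add: ennreal_le_iff)
    then have "card F \<le> \<bar>B\<bar> * measure \<mu> K / (s / 2)\<^sup>2"
      using s by (simp add: field_simps)
    then show ?thesis
      unfolding N_def by linarith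
  qed
  then have "finite (\<Gamma> \<inter> (+) x ` U) \<and> card (\<Gamma> \<inter> (+) x ` U) \<le> N" for x
    by (intro finite_if_finite_subsets_card_bdd) blast
  moreover have "0 \<in> interior U"
    using openU U0 by (simp add: interior_open)
  ultimately show ?thesis
    unfolding relatively_separated_def using cptU by blast
qed

text \<open>Cauchy-Schwarz on \<open>E\<close> and the substitution \<open>y = \<gamma> + z\<close>
  bound each coefficient by the measure of \<open>E\<close> times the integral of |\<phi>|^2 over
  \<open>- \<gamma> + E\<close>. Summing brings in the number of \<gamma> with
  \<open>\<gamma> + z \<in> E\<close>. Since \<open>- \<gamma> = z + - (\<gamma> + z)\<close> and
  \<open>E\<close> reflects into \<open>U\<close>, each such \<open>- \<gamma>\<close> lies in
  \<open>z + U\<close>, so there are at most \<open>N\<close>.\<close>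

lemma infsum_inner_indicator_le:
  fixes \<mu> :: "'a::{topological_group_add, t2_space} measure"
  assumes haar: "left_haar_measure \<mu>"
    and \<phi>: "\<phi> \<in> L2_space \<mu>" and E: "open E" "\<And>x. x \<in> E \<Longrightarrow> - x \<in> U"
    and N: "\<And>x. finite (uminus ` \<Gamma> \<inter> (+) x ` U) \<and> card (uminus ` \<Gamma> \<inter> (+) x ` U) \<le> N"
  shows "(\<Sum>\<^sub>\<infinity>\<gamma>\<in>\<Gamma>. ennreal ((cmod (L2_inner \<mu> (indicator E) (left_regular \<gamma> \<phi>)))\<^sup>2)) \<le>
    emeasure \<mu> E * (of_nat N *
      (\<integral>\<^sup>+z. ennreal ((cmod (\<phi> z))\<^sup>2) * indicator (\<Union>\<gamma>\<in>\<Gamma>. (+) (- \<gamma>) ` E) z \<partial>\<mu>))"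
proof (rule infsum_le_ennreal)
  fix F assume F: "finite F" "F \<subseteq> \<Gamma>"
  define T where "T = (\<Union>\<gamma>\<in>\<Gamma>. (+) (- \<gamma>) ` E)"
  have \<phi>_meas [measurable]: "\<phi> \<in> borel_measurable \<mu>"
    using \<phi> by (simp add: L2_space_def)
  have setsE [measurable]: "E \<in> sets \<mu>" and setsT [measurable]: "T \<in> sets \<mu>"
    using E(1) open_left_translation[OF E(1)]
    by (auto simp: sets_left_haar_measure[OF haar] T_def intro!: borel_open)
  have trans_meas [measurable]: "(+) \<gamma> \<in> \<mu> \<rightarrow>\<^sub>M \<mu>" for \<gamma>
    by (rule left_haar_measure_measurable_translation[OF haar])
  have "ennreal ((cmod (L2_inner \<mu> (indicator E) (left_regular \<gamma> \<phi>)))\<^sup>2) \<le>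
      emeasure \<mu> E * (\<integral>\<^sup>+z. ennreal ((cmod (\<phi> z))\<^sup>2) * indicator E (\<gamma> + z) \<partial>\<mu>)" for \<gamma>
  proof -
    have [measurable]: "left_regular \<gamma> \<phi> \<in> borel_measurable \<mu>"
      by (rule measurable_left_regular[OF haar \<phi>_meas])
    have "ennreal ((cmod (L2_inner \<mu> (indicator E) (left_regular \<gamma> \<phi>)))\<^sup>2) \<le>
        emeasure \<mu> E * (\<integral>\<^sup>+y. ennreal ((cmod (left_regular \<gamma> \<phi> y))\<^sup>2) * indicator E y \<partial>\<mu>)"
      unfolding L2_inner_def
      by (rule norm_integral_squared_le_emeasure_mult) (auto simp: norm_mult indicator_def)
    also have "(\<integral>\<^sup>+y. ennreal ((cmod (left_regular \<gamma> \<phi> y))\<^sup>2) * indicator E y \<partial>\<mu>) =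
        (\<integral>\<^sup>+z. ennreal ((cmod (left_regular \<gamma> \<phi> (\<gamma> + z)))\<^sup>2) * indicator E (\<gamma> + z) \<partial>\<mu>)"
      by (rule nn_integral_left_translation[OF haar, symmetric]) measurable
    finally show ?thesis
      by (simp add: left_regular_def)
  qed
  then have "(\<Sum>\<gamma>\<in>F. ennreal ((cmod (L2_inner \<mu> (indicator E) (left_regular \<gamma> \<phi>)))\<^sup>2)) \<le>
      (\<Sum>\<gamma>\<in>F. emeasure \<mu> E * (\<integral>\<^sup>+z. ennreal ((cmod (\<phi> z))\<^sup>2) * indicator E (\<gamma> + z) \<partial>\<mu>))"
    by (rule sum_mono)
  also have "\<dots> = emeasure \<mu> E *
      (\<integral>\<^sup>+z. (\<Sum>\<gamma>\<in>F. ennreal ((cmod (\<phi> z))\<^sup>2) * indicator E (\<gamma> + z)) \<partial>\<mu>)"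
    by (subst nn_integral_sum) (measurable, simp add: sum_distrib_left)
  also have "\<dots> \<le> emeasure \<mu> E *
      (\<integral>\<^sup>+z. of_nat N * (ennreal ((cmod (\<phi> z))\<^sup>2) * indicator T z) \<partial>\<mu>)"
  proof (intro mult_left_mono nn_integral_mono)
    fix z
    define P where "P = {\<gamma> \<in> F. \<gamma> + z \<in> E}"
    have "uminus ` P \<subseteq> uminus ` \<Gamma> \<inter> (+) z ` U"
    proof
      fix y assume "y \<in> uminus ` P"
      then obtain \<gamma> where \<gamma>: "y = - \<gamma>" "\<gamma> \<in> F" "\<gamma> + z \<in> E"
        by (auto simp: P_def)
      have "- \<gamma> = z + - (\<gamma> + z)"
        by (simp only: minus_add add_minus_cancel)
      with \<gamma> E(2)[OF \<gamma>(3)] F(2) show "y \<in> uminus ` \<Gamma> \<inter> (+) z ` U"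
        by blast
    qed
    then have "card (uminus ` P) \<le> N"
      using N[of z] card_mono order_trans by blast
    then have cardP: "card P \<le> N"
      by (simp add: card_image)
    have "(\<Sum>\<gamma>\<in>F. ennreal ((cmod (\<phi> z))\<^sup>2) * indicator E (\<gamma> + z)) =
        (\<Sum>\<gamma>\<in>P. ennreal ((cmod (\<phi> z))\<^sup>2))"
      unfolding P_def using F(1) by (intro sum.mono_neutral_cong_right) auto
    also have "\<dots> = of_nat (card P) * ennreal ((cmod (\<phi> z))\<^sup>2)"
      by simp
    also have "\<dots> \<le> of_nat N * (ennreal ((cmod (\<phi> z))\<^sup>2) * indicator T z)"
    proof (cases "P = {}")
      case False
      then obtain \<gamma> where "\<gamma> \<in> F" "\<gamma> + z \<in> E"
        by (auto simp: P_def)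
      then have "z \<in> T"
        using F(2) by (auto simp: T_def image_left_translation_eq_vimage)
      with cardP show ?thesis
        by (auto intro!: mult_right_mono)
    qed simp
    finally show "(\<Sum>\<gamma>\<in>F. ennreal ((cmod (\<phi> z))\<^sup>2) * indicator E (\<gamma> + z)) \<le>
      of_nat N * (ennreal ((cmod (\<phi> z))\<^sup>2) * indicator T z)" .
  qed simp
  also have "(\<integral>\<^sup>+z. of_nat N * (ennreal ((cmod (\<phi> z))\<^sup>2) * indicator T z) \<partial>\<mu>) =
      of_nat N * (\<integral>\<^sup>+z. ennreal ((cmod (\<phi> z))\<^sup>2) * indicator T z \<partial>\<mu>)"
    by (intro nn_integral_cmult) measurable
  finally show "(\<Sum>\<gamma>\<in>F. ennreal ((cmod (L2_inner \<mu> (indicator E) (left_regular \<gamma> \<phi>)))\<^sup>2)) \<le>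
      emeasure \<mu> E * (of_nat N *
      (\<integral>\<^sup>+z. ennreal ((cmod (\<phi> z))\<^sup>2) * indicator (\<Union>\<gamma>\<in>\<Gamma>. (+) (- \<gamma>) ` E) z \<partial>\<mu>))"
    unfolding T_def .
qed

section \<open>Contradiction from shrinking neighbourhoods of 0\<close>

theorem theorem2p6:
  fixes \<mu> :: "'a::{topological_group_add, t2_space, second_countable_topology} measure"
  assumes locally_compact: "locally_compact_space (euclidean :: 'a topology)"
    and non_discrete: "\<not> (\<forall>S::'a set. open S)"
    and haar: "left_haar_measure \<mu>"
    and inverse_separated:
      "\<And>\<Gamma>::'a set. relatively_separated \<Gamma> \<Longrightarrow> relatively_separated (uminus ` \<Gamma>)"
  shows "\<not> FT_group \<mu>"
proof
  assume "FT_group \<mu>"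
  then obtain \<Gamma> \<phi> A B where \<phi>: "\<phi> \<in> L2_space \<mu>" and A: "0 < A"
    and lower: "\<And>f. f \<in> L2_space \<mu> \<Longrightarrow> ennreal (A * (L2_norm \<mu> f)\<^sup>2) \<le>
      (\<Sum>\<^sub>\<infinity>x\<in>\<Gamma>. ennreal ((cmod (L2_inner \<mu> f (left_regular x \<phi>)))\<^sup>2))"
    and Bessel: "\<And>f. f \<in> L2_space \<mu> \<Longrightarrow>
      (\<Sum>\<^sub>\<infinity>x\<in>\<Gamma>. ennreal ((cmod (L2_inner \<mu> f (left_regular x \<phi>)))\<^sup>2)) \<le> ennreal (B * (L2_norm \<mu> f)\<^sup>2)"
    unfolding FT_group_def L2_frame_def by metis
  have \<phi>_meas [measurable]: "\<phi> \<in> borel_measurable \<mu>"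
    using \<phi> by (simp add: L2_space_def)
  obtain V K where V: "open V" "(0::'a) \<in> V" "V \<subseteq> K" and K: "compact K"
  proof -
    have "\<exists>V K. openin euclidean V \<and> compactin euclidean K \<and> (0::'a) \<in> V \<and> V \<subseteq> K"
      using locally_compact by (simp only: locally_compact_space_def topspace_euclidean ball_UNIV)
    then show ?thesis
      using that by (simp only: open_openin compactin_euclidean_iff) blast
  qed
  then have K0: "0 \<in> interior K"
    by (meson interiorI)
  have setsK: "K \<in> sets \<mu>"
    using K by (simp add: sets_left_haar_measure[OF haar] borel_compact)
  have finK: "emeasure \<mu> K < \<infinity>"
    by (rule left_haar_measure_compact_finite[OF haar K])
  have posK: "measure \<mu> K > 0"
  proof -
    have "0 < emeasure \<mu> V"
      by (rule left_haar_measure_open_pos[OF haar V(1,2)])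
    also have "\<dots> \<le> emeasure \<mu> K"
      by (rule emeasure_mono[OF V(3) setsK])
    finally show ?thesis
      using finK by (simp add: measure_def enn2real_positive_iff)
  qed
  \<comment> \<open>The indicator of \<open>K\<close> has positive norm, so the lower frame bound
    forbids all its coefficients to vanish.\<close>
  have "\<exists>x\<in>\<Gamma>. L2_inner \<mu> (indicator K) (left_regular x \<phi>) \<noteq> 0"
  proof (rule ccontr)
    assume "\<not> ?thesis"
    then have "(\<Sum>\<^sub>\<infinity>x\<in>\<Gamma>. ennreal ((cmod (L2_inner \<mu> (indicator K) (left_regular x \<phi>)))\<^sup>2)) = 0"
      by (intro infsum_0) simp
    with lower[OF indicator_L2_space[OF setsK finK]] A posK show False
      by (simp add: L2_norm_indicator[OF setsK] ennreal_eq_0_iff mult_le_0_iff)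
  qed
  then obtain x where "L2_inner \<mu> (indicator K) (left_regular x \<phi>) \<noteq> 0"
    by blast
  \<comment> \<open>Moving the translation from \<phi> to \<open>K\<close> gives a compact set,
    \<open>- x + K\<close>, whose indicator is not orthogonal to \<phi> itself, as
    \<open>Bessel_imp_relatively_separated\<close> requires.\<close>
  also have "L2_inner \<mu> (indicator K) (left_regular x \<phi>) =
      L2_inner \<mu> (left_regular (- x) (indicator K)) (left_regular (- x) (left_regular x \<phi>))"
    using setsK \<phi>_meas by (simp add: L2_inner_left_regular[OF haar] measurable_left_regular[OF haar])
  also have "\<dots> = L2_inner \<mu> (indicator ((+) (- x) ` K)) \<phi>"
    by (simp add: left_regular_add left_regular_indicator) (simp add: left_regular_def)
  finally have "L2_inner \<mu> (indicator ((+) (- x) ` K)) \<phi> \<noteq> 0" .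
  then have sep: "relatively_separated \<Gamma>"
    using Bessel_imp_relatively_separated[OF haar K K0 \<phi> Bessel]
      compact_continuous_image[OF continuous_left_translation K] by blast
  obtain U N where U: "0 \<in> interior U"
    and N: "\<And>x. finite (uminus ` \<Gamma> \<inter> (+) x ` U) \<and> card (uminus ` \<Gamma> \<inter> (+) x ` U) \<le> N"
    using inverse_separated[OF sep] unfolding relatively_separated_def by blast
  obtain G :: "nat \<Rightarrow> 'a set" where G: "\<And>n. open (G n)" "\<And>n. 0 \<in> G n"
    "\<And>S. open S \<Longrightarrow> 0 \<in> S \<Longrightarrow> eventually (\<lambda>n. G n \<subseteq> S) sequentially"
    using countable_basis_at_decseq[of "0::'a"] by metis
  \<comment> \<open>The reflected \<open>interior U\<close> gives every \<open>E n\<close> the same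
    overlap bound \<open>N\<close>, and \<open>V\<close> keeps its measure finite.\<close>
  define E where "E n = G n \<inter> uminus ` interior U \<inter> V" for n
  have E: "open (E n)" "0 \<in> E n" "E n \<subseteq> K" for n
    using G V U by (auto simp: E_def intro!: open_Int open_uminus_image image_eqI[where x=0])
  have EU: "- x \<in> U" if "x \<in> E n" for x n
    using that interior_subset[of U] by (auto simp: E_def)
  define T where "T n = (\<Union>\<gamma>\<in>\<Gamma>. (+) (- \<gamma>) ` E n)" for n
  define h where "h n z = ennreal ((cmod (\<phi> z))\<^sup>2) * indicator (T n) z" for n z
  have setsE: "E n \<in> sets \<mu>" and setsT [measurable]: "T n \<in> sets \<mu>" for n
    using E(1)[of n] open_left_translation[OF E(1)[of n]]
    by (auto simp: sets_left_haar_measure[OF haar] T_def intro!: borel_open)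
  have A_le: "ennreal A \<le> of_nat N * (\<integral>\<^sup>+z. h n z \<partial>\<mu>)" for n
  proof -
    have "emeasure \<mu> (E n) \<le> emeasure \<mu> K"
      by (rule emeasure_mono[OF E(3) setsK])
    with finK have fin: "emeasure \<mu> (E n) < \<infinity>"
      by simp
    have pos: "emeasure \<mu> (E n) > 0"
      by (rule left_haar_measure_open_pos[OF haar E(1,2)])
    have "emeasure \<mu> (E n) * ennreal A = ennreal (A * (L2_norm \<mu> (indicator (E n)))\<^sup>2)"
      using fin A
      by (simp add: L2_norm_indicator[OF setsE] emeasure_eq_ennreal_measure ennreal_mult mult.commute)
    also have "\<dots> \<le> emeasure \<mu> (E n) * (of_nat N * (\<integral>\<^sup>+z. h n z \<partial>\<mu>))"
      unfolding h_def T_def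
      using lower[OF indicator_L2_space[OF setsE fin]]
        infsum_inner_indicator_le[OF haar \<phi> E(1) EU N] by (rule order_trans)
    finally show ?thesis
      using fin pos by (simp add: ennreal_mult_le_mult_iff)
  qed
  have "(\<lambda>n. \<integral>\<^sup>+z. h n z \<partial>\<mu>) \<longlonglongrightarrow> (\<integral>\<^sup>+z. 0 \<partial>\<mu>)"
  proof (rule nn_integral_dominated_convergence)
    show "h n \<in> borel_measurable \<mu>" for n
      unfolding h_def by measurable
    show "(\<lambda>z. ennreal ((cmod (\<phi> z))\<^sup>2)) \<in> borel_measurable \<mu>"
      by measurable
    show "AE z in \<mu>. h n z \<le> ennreal ((cmod (\<phi> z))\<^sup>2)" for n
      by (auto simp: h_def indicator_def)
    show "(\<integral>\<^sup>+z. ennreal ((cmod (\<phi> z))\<^sup>2) \<partial>\<mu>) < \<infinity>"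
      by (rule L2_space_nn_integral_finite[OF \<phi>])
    have "(\<Union>y\<in>uminus ` \<Gamma>. {y}) \<in> null_sets \<mu>"
      using relatively_separated_countable[OF sep] left_haar_measure_singleton[OF haar K K0 non_discrete]
      by (intro null_sets_UN') (auto simp: null_sets_def sets_left_haar_measure[OF haar])
    then have "AE z in \<mu>. z \<notin> uminus ` \<Gamma>"
      using AE_not_in by fastforce
    then show "AE z in \<mu>. (\<lambda>n. h n z) \<longlonglongrightarrow> 0"
    proof eventually_elim
      case (elim z)
      txt \<open>Only the finitely many \<open>\<gamma>\<close> with \<open>- \<gamma> \<in> z + U\<close> can contribute at \<open>z\<close>, whatever \<open>n\<close> is.\<close>
      define S where "S = (+) (- z) ` (uminus ` \<Gamma> \<inter> (+) z ` U)"
      have "finite S"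
        unfolding S_def using N[of z] by (intro finite_imageI) blast
      \<comment> \<open>The elements of \<open>S\<close> are the points
        \<open>- (\<gamma> + z)\<close> in \<open>U\<close> with \<gamma> in \<Gamma>; 0 among them
        would put \<open>z\<close> in the inverse of \<Gamma>. As \<open>S\<close> is finite, its
        reflected complement is an open neighbourhood of 0, which contains \<open>G n\<close> for
        large \<open>n\<close> and so keeps every \<open>\<gamma> + z\<close> out of
        \<open>E n\<close>.\<close>
      have "0 \<notin> S"
        using elim by (auto simp: S_def image_left_translation_eq_vimage)
      then have "open (uminus ` (- S))" "0 \<in> uminus ` (- S)"
        using \<open>finite S\<close>
        by (auto intro!: open_uminus_image finite_imp_closed image_eqI[where x=0])
      then have "eventually (\<lambda>n. G n \<subseteq> uminus ` (- S)) sequentially"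
        by (rule G(3))
      then have "eventually (\<lambda>n. h n z = 0) sequentially"
      proof eventually_elim
        case (elim n)
        have "z \<notin> T n"
        proof
          assume "z \<in> T n"
          then obtain \<gamma> where \<gamma>: "\<gamma> \<in> \<Gamma>" "\<gamma> + z \<in> E n"
            by (auto simp: T_def image_left_translation_eq_vimage)
          have eq: "- \<gamma> = z + - (\<gamma> + z)"
            by (simp only: minus_add add_minus_cancel)
          then have "- \<gamma> \<in> uminus ` \<Gamma> \<inter> (+) z ` U"
            using \<gamma> EU by blast
          moreover have "- (\<gamma> + z) = - z + - \<gamma>"
            by (rule minus_add)
          ultimately have "- (\<gamma> + z) \<in> S"
            unfolding S_def by blast
          moreover have "\<gamma> + z \<in> uminus ` (- S)"
            using \<gamma>(2) elim by (auto simp: E_def)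
          ultimately show False
            by auto
        qed
        then show ?case
          by (simp add: h_def)
      qed
      then show ?case
        by (rule tendsto_eventually)
    qed
  qed simp
  then have "(\<lambda>n. of_nat N * (\<integral>\<^sup>+z. h n z \<partial>\<mu>)) \<longlonglongrightarrow> of_nat N * 0"
    by (intro ennreal_tendsto_cmult) (simp_all add: of_nat_less_top)
  then have "ennreal A \<le> 0"
    using A_le by (intro LIMSEQ_le_const[of _ 0]) auto
  with A show False
    by simp
qed

end
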